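(* Let $n\ge2$ and let $\mathbb{S}^n\subset\mathbb{R}^{n+1}$ be the unit sphere. The standard distance on $\mathbb{S}^n$, $(p,q)\mapsto\arccos(p\cdot q)$ for $p,q\in\mathbb{S}^n$ (where $p\cdot q$ is the Euclidean inner product in $\mathbb{R}^{n+1}$), and its square $(p,q)\mapsto\arccos^2(p\cdot q)$ both have full rank a.e. on $\mathbb{S}^n$.
   Context: A function $\psi:\mathbb{S}^n\times\mathbb{S}^n\to\mathbb{R}$ has full rank almost everywhere (a.e.) on $\mathbb{S}^n$ if for any $k\in\mathbb{N}$ and any nonempty (relatively) open sets $U_i,V_j\subset\mathbb{S}^n$, $i,j=1,\dots,k$, there exist $p_i\in U_i$ and $q_j\in V_j$ such that the $k\times k$ matrix $\{\psi(p_i,q_j)\}_{i,j=1}^k$ has rank $k$. *)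

theory Defs
  imports
    "HOL-Analysis.Analysis"
    "Jordan_Normal_Form.DL_Rank"
begin

text \<open>The unit sphere of \<open>\<real>\<^sup>n\<^sup>+\<^sup>1\<close> is \<open>sphere 0 1\<close> in a Euclidean space of dimension \<open>n + 1\<close>;
  only the values of \<open>\<psi>\<close> on pairs of points of the sphere matter. The indices \<open>1, \<dots>, k\<close> are
  shifted to \<open>0, \<dots>, k - 1\<close>, and \<open>vec_space.rank k\<close> is the rank of a real matrix with \<open>k\<close> rows.\<close>

definition full_rank_ae :: "('a::euclidean_space \<Rightarrow> 'a \<Rightarrow> real) \<Rightarrow> bool" where
  "full_rank_ae \<psi> \<longleftrightarrow>
    (\<forall>(k::nat) (U :: nat \<Rightarrow> 'a set) (V :: nat \<Rightarrow> 'a set).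
      (\<forall>i<k. openin (top_of_set (sphere 0 1)) (U i) \<and> U i \<noteq> {}) \<longrightarrow>
      (\<forall>j<k. openin (top_of_set (sphere 0 1)) (V j) \<and> V j \<noteq> {}) \<longrightarrow>
      (\<exists>p q. (\<forall>i<k. p i \<in> U i) \<and> (\<forall>j<k. q j \<in> V j) \<and>
        vec_space.rank k (mat k k (\<lambda>(i, j). \<psi> (p i) (q j))) = k))"

end

theory Submission
  imports Defs "HOL-Complex_Analysis.Complex_Analysis"
begin

text \<open>By induction on \<open>k\<close> and Laplace expansion along the last row, it suffices to find \<open>q\<close> in the
  last \<open>V\<close> such that no relation \<open>(\<Sum>j. c j * \<psi> p (q j)) + d * \<psi> p q = 0\<close> with \<open>d \<noteq> 0\<close> holds for all \<open>p\<close>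
  in the last \<open>U\<close>. Since the dimension is at least 3, \<open>p\<^sub>0 \<in> U\<close> and \<open>q \<in> V\<close> can be chosen so that the great
  circle through them avoids all \<open>q j\<close>. On that circle the terms \<open>\<psi> p (q j)\<close> are analytic and periodic,
  but \<open>\<psi> p q\<close> is locally a nonconstant polynomial in arc length, which forces \<open>d = 0\<close>.\<close>

section \<open>Ranks, generic points of the sphere, orthogonal projections\<close>

lemma vec_space_rank_iff_det:
  fixes A :: "'a::field mat"
  assumes "A \<in> carrier_mat n n"
  shows "vec_space.rank n A = n \<longleftrightarrow> Determinant.det A \<noteq> 0"
  using vec_space.det_rank_iff[OF assms] by simp

text \<open>The open cone over \<open>U\<close> has positive measure, while finitely many proper
  subspaces form a null set. Subspaces are invariant under scaling, so a point of the cone outside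
  them can be normalised into \<open>U\<close>.\<close>

lemma openin_sphere_avoid_subspaces:
  fixes U :: "'a::euclidean_space set" and \<S> :: "'a set set"
  assumes U: "openin (top_of_set (sphere 0 1)) U" "U \<noteq> {}"
    and fin: "finite \<S>"
    and sub: "\<And>S. S \<in> \<S> \<Longrightarrow> Real_Vector_Spaces.subspace S"
    and dim: "\<And>S. S \<in> \<S> \<Longrightarrow> dim S < DIM('a)"
  obtains x where "x \<in> U" "x \<notin> \<Union>\<S>"
proof -
  obtain T where T: "open T" "U = sphere 0 1 \<inter> T"
    using U(1) by (auto simp: openin_open)
  let ?C = "(-{0}) \<inter> (\<lambda>x::'a. x /\<^sub>R norm x) -` T"
  have "continuous_on (-{0}) (\<lambda>x::'a. x /\<^sub>R norm x)"
    by (intro continuous_intros) simp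
  then have "open ?C"
    by (rule continuous_open_preimage[OF _ open_Compl[OF closed_singleton] T(1)])
  moreover have "?C \<noteq> {}"
  proof -
    obtain u where "u \<in> U" using U(2) by blast
    then have "u \<in> ?C" using T by auto
    then show ?thesis by blast
  qed
  ultimately have "\<not> negligible ?C" by (rule open_not_negligible)
  moreover have "negligible (\<Union>\<S>)"
    using fin dim by (intro negligible_Union negligible_lowdim) auto
  ultimately have "\<not> ?C \<subseteq> \<Union>\<S>"
    using negligible_subset[of "\<Union>\<S>" ?C] by satx
  then obtain y where y: "y \<in> ?C" "y \<notin> \<Union>\<S>"
    by (meson subsetI)
  have "y /\<^sub>R norm y \<in> U" using y T by auto
  moreover have "y /\<^sub>R norm y \<notin> \<Union>\<S>"
  proof
    assume "y /\<^sub>R norm y \<in> \<Union>\<S>"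
    then obtain S where S: "S \<in> \<S>" "y /\<^sub>R norm y \<in> S" by blast
    have "norm y *\<^sub>R (y /\<^sub>R norm y) \<in> S"
      using S sub Real_Vector_Spaces.subspace_scale by blast
    then show False using y S(1) by auto
  qed
  ultimately show ?thesis using that by blast
qed

text \<open>Pythagoras for the orthonormal pair \<open>p\<close>, \<open>v\<close>. It turns
  distance from their plane into a strict bound on the two coefficients.\<close>

lemma norm_diff_projection2_sq:
  fixes p v q :: "'a::real_inner"
  assumes "norm p = 1" "norm v = 1" "inner p v = 0"
  shows "(norm (q - inner p q *\<^sub>R p - inner v q *\<^sub>R v))\<^sup>2
           = (norm q)\<^sup>2 - (inner p q)\<^sup>2 - (inner v q)\<^sup>2"
proof -
  have *: "inner p p = 1" "inner v v = 1" "inner v p = 0"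
    using assms by (auto simp: norm_eq_1 inner_commute)
  define a b where ab: "a = inner p q" "b = inner v q"
  have "inner q p = a" "inner q v = b"
    by (simp_all add: ab inner_commute)
  with * assms(3) show ?thesis
    unfolding power2_norm_eq_inner ab[symmetric]
    by (simp add: inner_diff_left inner_diff_right power2_eq_square flip: ab)
qed

section \<open>Analytic continuation of trigonometric relations\<close>

lemma abs_trig_combination_le:
  fixes a b x :: real
  shows "\<bar>a * cos x + b * sin x\<bar> \<le> sqrt (a\<^sup>2 + b\<^sup>2)"
proof (rule real_le_rsqrt)
  \<comment> \<open>Lagrange's identity, the quantitative form of Cauchy-Schwarz in the
    plane.\<close>
  have "(a * u + b * v)\<^sup>2 + (a * v - b * u)\<^sup>2 = (a\<^sup>2 + b\<^sup>2) * (v\<^sup>2 + u\<^sup>2)" for u v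
    by (simp add: power2_eq_square algebra_simps)
  from this[of "cos x" "sin x"] have "(a * cos x + b * sin x)\<^sup>2 + (a * sin x - b * cos x)\<^sup>2 = a\<^sup>2 + b\<^sup>2" by simp
  then show "\<bar>a * cos x + b * sin x\<bar>\<^sup>2 \<le> a\<^sup>2 + b\<^sup>2"
    unfolding power2_abs using zero_le_power2[of "a * sin x - b * cos x"] by linarith
qed

text \<open>The real part of the argument is its value at \<open>Re z\<close> times
  \<open>cosh (Im z)\<close>, so on the strip it stays in (-1, 1). This avoids the branch cuts of
  \<open>Arccos\<close>, which lie on the real axis outside that interval.\<close>

lemma Arccos_trig_holomorphic_on_strip:
  fixes a b \<delta> :: real
  assumes "sqrt (a\<^sup>2 + b\<^sup>2) * cosh \<delta> < 1"
  shows "(\<lambda>z. Arccos (of_real a * cos z + of_real b * sin z)) holomorphic_on {z. \<bar>Im z\<bar> < \<delta>}"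
proof -
  have "\<bar>Re (of_real a * cos z + of_real b * sin z)\<bar> < 1" if "\<bar>Im z\<bar> < \<delta>" for z
  proof -
    have "cosh (Im z) \<le> cosh \<delta>"
      using that cosh_real_nonneg_le_iff[of "\<bar>Im z\<bar>" \<delta>] by (simp add: abs_if split: if_splits)
    have "Re (of_real a * cos z + of_real b * sin z)
            = (a * cos (Re z) + b * sin (Re z)) * cosh (Im z)"
      by (simp add: Re_cos Re_sin cosh_def field_simps)
    then have "\<bar>Re (of_real a * cos z + of_real b * sin z)\<bar>
        = \<bar>a * cos (Re z) + b * sin (Re z)\<bar> * cosh (Im z)"
      by (simp add: abs_mult)
    also have "\<dots> \<le> sqrt (a\<^sup>2 + b\<^sup>2) * cosh \<delta>"
      by (intro mult_mono abs_trig_combination_le) (use \<open>cosh (Im z) \<le> cosh \<delta>\<close> in auto)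
    finally show ?thesis using assms by simp
  qed
  then have "Arccos holomorphic_on (\<lambda>z. of_real a * cos z + of_real b * sin z) ` {z. \<bar>Im z\<bar> < \<delta>}"
    by (intro holomorphic_on_Arccos) auto
  then have "Arccos \<circ> (\<lambda>z. of_real a * cos z + of_real b * sin z) holomorphic_on {z. \<bar>Im z\<bar> < \<delta>}"
    by (intro holomorphic_on_compose holomorphic_intros)
  then show ?thesis by (simp add: o_def)
qed

text \<open>The relation extends from the interval to all real arguments by analytic continuation along
  a complex strip; the sum is \<open>2 * pi\<close>-periodic, whereas \<open>(\<alpha> - t) ^ m\<close> is not.\<close>

lemma arccos_trig_relation_coeff_zero:
  fixes a b c :: "'j \<Rightarrow> real" and \<alpha> d \<epsilon> :: real
  assumes J: "finite J" "\<And>j. j \<in> J \<Longrightarrow> (a j)\<^sup>2 + (b j)\<^sup>2 < 1"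
    and m: "m > 0" and \<epsilon>: "\<epsilon> > 0"
    and rel: "\<And>t. \<bar>t\<bar> < \<epsilon> \<Longrightarrow>
      (\<Sum>j\<in>J. c j * arccos (a j * cos t + b j * sin t) ^ m) + d * (\<alpha> - t) ^ m = 0"
  shows "d = 0"
proof -
  \<comment> \<open>Each amplitude is below 1 and \<open>cosh 0 = 1\<close>, so by continuity and
    finiteness of \<open>J\<close> one strip width serves all terms.\<close>
  have "\<forall>j\<in>J. \<forall>\<^sub>F \<delta> in at_right 0. sqrt ((a j)\<^sup>2 + (b j)\<^sup>2) * cosh \<delta> < 1"
  proof
    fix j assume "j \<in> J"
    have "((\<lambda>\<delta>. sqrt ((a j)\<^sup>2 + (b j)\<^sup>2) * cosh \<delta>) \<longlongrightarrow> sqrt ((a j)\<^sup>2 + (b j)\<^sup>2) * cosh 0) (at_right 0)"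
      by (intro tendsto_intros)
    moreover have "sqrt ((a j)\<^sup>2 + (b j)\<^sup>2) * cosh 0 < 1"
      using J(2)[OF \<open>j \<in> J\<close>] by (simp add: real_sqrt_lt_1_iff)
    ultimately show "\<forall>\<^sub>F \<delta> in at_right 0. sqrt ((a j)\<^sup>2 + (b j)\<^sup>2) * cosh \<delta> < 1"
      by (rule order_tendstoD(2))
  qed
  then have "\<forall>\<^sub>F \<delta> in at_right 0. \<forall>j\<in>J. sqrt ((a j)\<^sup>2 + (b j)\<^sup>2) * cosh \<delta> < 1"
    using J(1) by (simp add: eventually_ball_finite)
  then have "\<forall>\<^sub>F \<delta> in at_right 0. \<delta> > 0 \<and> (\<forall>j\<in>J. sqrt ((a j)\<^sup>2 + (b j)\<^sup>2) * cosh \<delta> < 1)"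
    using eventually_at_right_less eventually_conj by blast
  then obtain \<delta> where \<delta>: "\<delta> > 0" "\<And>j. j \<in> J \<Longrightarrow> sqrt ((a j)\<^sup>2 + (b j)\<^sup>2) * cosh \<delta> < 1"
    using eventually_happens' trivial_limit_at_right_real by (metis (mono_tags, lifting))
  define S where "S = {z. \<bar>Im z\<bar> < \<delta>}"
  \<comment> \<open>The complex extension of the left side of the relation, which vanishes on a real
    interval accumulating at 0.\<close>
  define F where "F z = (\<Sum>j\<in>J. of_real (c j) * Arccos (of_real (a j) * cos z + of_real (b j) * sin z) ^ m)
      + of_real d * (of_real \<alpha> - z) ^ m" for z
  have real_in_S: "of_real t \<in> S" for t using \<delta>(1) by (simp add: S_def)
  have F_real: "F (of_real t) = of_real
      ((\<Sum>j\<in>J. c j * arccos (a j * cos t + b j * sin t) ^ m) + d * (\<alpha> - t) ^ m)" for t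
  proof -
    have "Arccos (of_real (a j) * cos (of_real t) + of_real (b j) * sin (of_real t))
        = of_real (arccos (a j * cos t + b j * sin t))" if "j \<in> J" for j
    proof -
      have "sqrt ((a j)\<^sup>2 + (b j)\<^sup>2) \<le> 1" using J(2)[OF that] by simp
      then have "\<bar>a j * cos t + b j * sin t\<bar> \<le> 1"
        using abs_trig_combination_le order_trans by blast
      then show ?thesis
        by (simp add: of_real_arccos cos_of_real[symmetric] sin_of_real[symmetric] 
             del: cos_of_real sin_of_real)
    qed
    then show ?thesis unfolding F_def by simp
  qed
  have S_eq: "S = {z. Im z < \<delta>} \<inter> {z. Im z > -\<delta>}" by (auto simp: S_def)
  have F_zero: "F (of_real t) = 0" for t
  proof (rule analytic_continuation[where f=F and S=S and U="of_real ` ball 0 \<epsilon>" and \<xi>=0])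
    show "F holomorphic_on S"
      unfolding F_def S_def
      using \<delta>(2) by (intro holomorphic_intros Arccos_trig_holomorphic_on_strip) auto
    show "open S" unfolding S_eq by (intro open_Int open_halfspace_Im_lt open_halfspace_Im_gt)
    have "convex S" unfolding S_eq by (intro convex_Int convex_halfspace_Im_lt convex_halfspace_Im_gt)
    then show "connected S" by (rule convex_connected)
    show "of_real ` ball 0 \<epsilon> \<subseteq> S" using real_in_S by auto
    show "0 \<in> S" using real_in_S[of 0] by simp
    have "(0::real) islimpt ball 0 \<epsilon>" using \<epsilon> by (simp add: islimpt_ball)
    then have "complex_of_real 0 islimpt of_real ` ball 0 \<epsilon>"
      by (intro islimpt_isCont_image)
         (auto simp: eventually_at_filter)
    then show "(0::complex) islimpt of_real ` ball 0 \<epsilon>" by simp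
    show "F z = 0" if "z \<in> of_real ` ball 0 \<epsilon>" for z
      using that rel by (auto simp: F_real simp del: of_real_add of_real_sum of_real_mult of_real_power)
    show "of_real t \<in> S" by (rule real_in_S)
  qed
  have "(\<Sum>j\<in>J. c j * arccos (a j * cos t + b j * sin t) ^ m) + d * (\<alpha> - t) ^ m = 0" for t
    using F_zero[of t] unfolding F_real of_real_eq_0_iff .
  \<comment> \<open>The two arguments differ by a period, so the sums agree, while the power of
    \<open>\<alpha> - t\<close> is 0 at the first and nonzero at the second.\<close>
  from this[of \<alpha>] this[of "\<alpha> + 2 * pi"] have "d * 0 ^ m = d * (- (2 * pi)) ^ m"
    by (simp only: cos_periodic sin_periodic) (simp add: add_eq_0_iff del: mult_cancel_left mult_cancel_right)
  then have "d * (- (2 * pi)) ^ m = 0" using m by (simp only: zero_power mult_zero_right)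
  then show "d = 0" by simp
qed

text \<open>Along the great circle through \<open>p\<^sub>0\<close> and \<open>q\<close>, the distance to \<open>q\<close> is affine near \<open>p\<^sub>0\<close>, and
  the distance to a point \<open>r j\<close> off the circle is analytic on the whole circle.\<close>

lemma arccos_power_coeff_zero:
  fixes U :: "'a::euclidean_space set" and p0 q :: 'a and r :: "'j \<Rightarrow> 'a"
  assumes U: "openin (top_of_set (sphere 0 1)) U" "p0 \<in> U"
    and q: "norm q = 1" "q \<notin> span {p0}"
    and J: "finite J" "\<And>j. j \<in> J \<Longrightarrow> norm (r j) = 1" "\<And>j. j \<in> J \<Longrightarrow> r j \<notin> span {p0, q}"
    and m: "m > 0"
    and rel: "\<And>p. p \<in> U \<Longrightarrow>
      (\<Sum>j\<in>J. c j * arccos (inner p (r j)) ^ m) + d * arccos (inner p q) ^ m = 0"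
  shows "d = 0"
proof -
  obtain T where T: "open T" "U = sphere 0 1 \<inter> T"
    using U(1) by (auto simp: openin_open)
  have p0: "norm p0 = 1" using U(2) T by auto
  define x where "x = inner p0 q"
  \<comment> \<open>Gram-Schmidt: \<open>w\<close> is the component of \<open>q\<close> orthogonal
    to \<open>p0\<close>, nonzero because \<open>q\<close> is off the line of
    \<open>p0\<close>.\<close>
  define w where "w = q - x *\<^sub>R p0"
  have "w \<noteq> 0"
    using q(2) by (auto simp: w_def span_singleton)
  have norm_w: "(norm w)\<^sup>2 = 1 - x\<^sup>2"
  proof -
    have "inner p0 p0 = 1" "inner q q = 1" "inner p0 q = x" "inner q p0 = x"
      using p0 q(1) by (auto simp: norm_eq_1 x_def inner_commute)
    then show ?thesis
      unfolding power2_norm_eq_inner w_def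
      by (simp add: inner_diff_left inner_diff_right power2_eq_square)
  qed
  have "x\<^sup>2 < 1" using norm_w \<open>w \<noteq> 0\<close> zero_less_power[of "norm w" 2] by (simp add: zero_less_norm_iff)
  then have x: "-1 < x" "x < 1" by (auto simp: abs_square_less_1)
  define \<alpha> where "\<alpha> = arccos x"
  have \<alpha>: "0 < \<alpha>" "\<alpha> < pi" "cos \<alpha> = x" using x arccos_lt_bounded by (auto simp: \<alpha>_def)
  define v where "v = w /\<^sub>R norm w"
  have v: "norm v = 1" using \<open>w \<noteq> 0\<close> by (simp add: v_def)
  have "inner p0 w = 0" using p0 by (simp add: w_def x_def inner_diff_right norm_eq_1)
  then have p0v: "inner p0 v = 0" by (simp add: v_def)
  have sin_\<alpha>: "sin \<alpha> = norm w"
    using x norm_w by (simp add: \<alpha>_def sin_arccos real_sqrt_unique)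
  have q_eq: "q = x *\<^sub>R p0 + norm w *\<^sub>R v" using \<open>w \<noteq> 0\<close> by (simp add: v_def w_def)
  have vq: "inner v q = sin \<alpha>"
    using p0v v by (simp add: q_eq inner_add_right inner_commute[of v p0] sin_\<alpha> norm_eq_1)
  have v_span: "v \<in> span {p0, q}"
    unfolding v_def w_def by (intro span_scale span_diff span_base) auto
  \<comment> \<open>The unit-speed great circle with \<open>\<gamma> 0 = p0\<close> and
    \<open>\<gamma> \<alpha> = q\<close>.\<close>
  define \<gamma> where "\<gamma> t = cos t *\<^sub>R p0 + sin t *\<^sub>R v" for t
  have norm_\<gamma>: "norm (\<gamma> t) = 1" for t
    using p0 p0v v
    by (simp add: \<gamma>_def norm_eq_1 inner_add_left inner_add_right inner_commute[of v p0]
        power2_eq_square[symmetric])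
  have "continuous_on UNIV \<gamma>" unfolding \<gamma>_def by (intro continuous_intros)
  then have "open (\<gamma> -` T)" using T(1) by (simp add: open_vimage)
  moreover have "0 \<in> \<gamma> -` T" using U(2) T by (simp add: \<gamma>_def)
  ultimately obtain e where e: "e > 0" "ball 0 e \<subseteq> \<gamma> -` T"
    by (rule openE)
  \<comment> \<open>The bound \<open>e\<close> keeps \<open>\<gamma> t\<close> in \<open>U\<close>;
    the other two keep \<open>\<alpha> - t\<close> between 0 and \<open>pi\<close>, where
    \<open>arccos\<close> inverts \<open>cos\<close>.\<close>
  define \<epsilon> where "\<epsilon> = min e (min \<alpha> (pi - \<alpha>))"
  have \<epsilon>: "\<epsilon> > 0" using e \<alpha> by (simp add: \<epsilon>_def)
  show ?thesis
  proof (rule arccos_trig_relation_coeff_zero[where J=J and a="\<lambda>j. inner p0 (r j)"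
        and b="\<lambda>j. inner v (r j)" and c=c and \<alpha>=\<alpha>, OF J(1) _ m \<epsilon>])
    fix j assume j: "j \<in> J"
    have "r j - inner p0 (r j) *\<^sub>R p0 - inner v (r j) *\<^sub>R v \<noteq> 0"
    proof
      assume "r j - inner p0 (r j) *\<^sub>R p0 - inner v (r j) *\<^sub>R v = 0"
      then have "r j = inner p0 (r j) *\<^sub>R p0 + inner v (r j) *\<^sub>R v" by (simp add: algebra_simps)
      also have "\<dots> \<in> span {p0, q}"
        by (intro span_add span_scale v_span) (simp add: span_base)
      finally show False using J(3)[OF j] by blast
    qed
    then have "(norm (r j - inner p0 (r j) *\<^sub>R p0 - inner v (r j) *\<^sub>R v))\<^sup>2 > 0"
      by simp
    then show "(inner p0 (r j))\<^sup>2 + (inner v (r j))\<^sup>2 < 1"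
      unfolding norm_diff_projection2_sq[OF p0 v p0v] using J(2)[OF j] by simp
  next
    fix t :: real assume t: "\<bar>t\<bar> < \<epsilon>"
    then have "\<gamma> t \<in> U" using e(2) T(2) norm_\<gamma> by (auto simp: \<epsilon>_def)
    moreover have "arccos (inner (\<gamma> t) q) = \<alpha> - t"
    proof -
      have "inner (\<gamma> t) q = cos (\<alpha> - t)"
        by (simp add: \<gamma>_def inner_add_left vq x_def[symmetric] \<alpha>(3) cos_diff mult.commute)
      then show ?thesis using t by (auto simp: \<epsilon>_def intro!: arccos_cos)
    qed
    ultimately show "(\<Sum>j\<in>J. c j * arccos (inner p0 (r j) * cos t + inner v (r j) * sin t) ^ m)
        + d * (\<alpha> - t) ^ m = 0"
      using rel[of "\<gamma> t"] by (simp add: \<gamma>_def inner_add_left mult.commute)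
  qed
qed

section \<open>General position and induction on determinants\<close>

lemma generic_great_circle:
  fixes U V Z :: "'a::euclidean_space set"
  assumes dim: "DIM('a) \<ge> 3"
    and U: "openin (top_of_set (sphere 0 1)) U" "U \<noteq> {}"
    and V: "openin (top_of_set (sphere 0 1)) V" "V \<noteq> {}"
    and Z: "finite Z" "0 \<notin> Z"
  obtains x y where "x \<in> U" "y \<in> V" "y \<notin> span {x}" "\<And>z. z \<in> Z \<Longrightarrow> z \<notin> span {x, y}"
proof -
  have dim_span_lt: "dim (span X) < DIM('a)" if "finite X" "card X \<le> 2" for X :: "'a set"
  proof -
    have "dim (span X) \<le> card X" using dim_le_card[OF order_refl that(1)] .
    then show ?thesis using that(2) dim by linarith
  qed
  \<comment> \<open>\<open>x\<close> is chosen first, off the lines through the points of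
    \<open>Z\<close>, so that each \<open>span {z, x}\<close> is a plane to be avoided by
    \<open>y\<close>. Dimension at least 3 makes these planes proper.\<close>
  have "\<exists>x. x \<in> U \<and> x \<notin> \<Union>((\<lambda>z. span {z}) ` Z)"
    by (rule openin_sphere_avoid_subspaces[OF U, of "(\<lambda>z. span {z}) ` Z"])
       (auto intro!: dim_span_lt Z(1) simp del: dim_span)
  then obtain x where x: "x \<in> U" "x \<notin> \<Union>((\<lambda>z. span {z}) ` Z)" by blast
  let ?\<S> = "insert (span {x}) ((\<lambda>z. span {z, x}) ` Z)"
  have "\<exists>y. y \<in> V \<and> y \<notin> \<Union>?\<S>"
    by (rule openin_sphere_avoid_subspaces[OF V, of ?\<S>])
       (auto intro!: dim_span_lt Z(1) simp: card_insert_if simp del: dim_span)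
  then obtain y where y: "y \<in> V" "y \<notin> \<Union>?\<S>" by blast
  show ?thesis
  proof (rule that[OF x(1) y(1)])
    show "y \<notin> span {x}" using y(2) by blast
    fix z assume z: "z \<in> Z"
    show "z \<notin> span {x, y}"
    proof
      assume in_span: "z \<in> span {x, y}"
      have "z \<notin> span {x}"
      \<comment> \<open>Exchange: as \<open>z\<close> is nonzero, \<open>z\<close> on the line of
        \<open>x\<close> would put \<open>x\<close> on the line of \<open>z\<close>. The same
        exchange below moves \<open>y\<close> into \<open>span {z, x}\<close>.\<close>
      proof
        assume "z \<in> span {x}"
        moreover have "z \<notin> span {}" using z Z(2) by auto
        ultimately have "x \<in> span {z}" by (rule in_span_insert)
        then show False using x(2) z by blast
      qed
      then have "y \<in> span {z, x}"
        using in_span_insert[of z y "{x}"] in_span by (simp add: insert_commute)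
      then show False using y(2) z by blast
    qed
  qed
qed

text \<open>Only the last row depends on \<open>x\<close>, so the cofactors along it are constants,
  and the corner one is the smaller determinant.\<close>

lemma det_bordered_expansion:
  fixes \<psi> :: "'a \<Rightarrow> 'b \<Rightarrow> 'c::comm_ring_1"
  shows "\<exists>C. \<forall>x. Determinant.det (mat (Suc k) (Suc k) (\<lambda>(i, j). \<psi> ((p(k := x)) i) ((q(k := y)) j)))
    = (\<Sum>j<k. C j * \<psi> x (q j)) + Determinant.det (mat k k (\<lambda>(i, j). \<psi> (p i) (q j))) * \<psi> x y"
proof -
  define B where "B x = mat (Suc k) (Suc k) (\<lambda>(i, j). \<psi> ((p(k := x)) i) ((q(k := y)) j))" for x
  \<comment> \<open>Deleting row \<open>k\<close> removes every occurrence of the point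
    \<open>undefined\<close>.\<close>
  define C where "C j = cofactor (B undefined) k j" for j
  have cofactor: "cofactor (B x) k j = C j" for x j
  proof -
    have "mat_delete (B x) k j = mat_delete (B undefined) k j"
      by (rule eq_matI) (auto simp: B_def mat_delete_def)
    then show ?thesis by (simp add: C_def cofactor_def)
  qed
  have C_k: "C k = Determinant.det (mat k k (\<lambda>(i, j). \<psi> (p i) (q j)))"
  proof -
    have "mat_delete (B undefined) k k = mat k k (\<lambda>(i, j). \<psi> (p i) (q j))"
      by (rule eq_matI) (auto simp: B_def mat_delete_def)
    then show ?thesis by (simp add: C_def cofactor_def)
  qed
  have "Determinant.det (B x) = (\<Sum>j<k. C j * \<psi> x (q j)) + C k * \<psi> x y" for x
  proof -
    have "Determinant.det (B x) = (\<Sum>j<Suc k. B x $$ (k, j) * cofactor (B x) k j)"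
      by (rule laplace_expansion_row) (auto simp: B_def)
    also have "\<dots> = (\<Sum>j<Suc k. C j * \<psi> x ((q(k := y)) j))"
      unfolding cofactor by (rule sum.cong) (simp_all add: B_def)
    finally show ?thesis by simp
  qed
  then show ?thesis unfolding B_def C_k by blast
qed

text \<open>The exponent treats the distance and its square together. The induction keeps a nonzero
  determinant, which becomes the coefficient of the new term at the next size.\<close>

lemma full_rank_ae_arccos_power:
  fixes m :: nat
  assumes dim: "DIM('a::euclidean_space) \<ge> 3" and m: "m > 0"
  shows "full_rank_ae (\<lambda>p q :: 'a. arccos (inner p q) ^ m)"
proof -
  define \<psi> where "\<psi> = (\<lambda>p q :: 'a. arccos (inner p q) ^ m)"
  let ?op = "openin (top_of_set (sphere (0::'a) 1))"
  have norm_open: "norm x = 1" if "?op W" "x \<in> W" for W x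
    using openin_imp_subset[OF that(1)] that(2) by auto
  have "\<exists>p q. (\<forall>i<k. p i \<in> U i) \<and> (\<forall>j<k. q j \<in> V j) \<and>
      Determinant.det (mat k k (\<lambda>(i, j). \<psi> (p i) (q j))) \<noteq> 0"
    if "\<forall>i<k. ?op (U i) \<and> U i \<noteq> {}" "\<forall>j<k. ?op (V j) \<and> V j \<noteq> {}" for k and U V :: "nat \<Rightarrow> 'a set"
    using that
  proof (induction k)
    case 0
    then show ?case by simp
  next
    case (Suc k)
    have "\<forall>i<k. ?op (U i) \<and> U i \<noteq> {}" "\<forall>j<k. ?op (V j) \<and> V j \<noteq> {}"
      using Suc.prems by auto
    from Suc.IH[OF this] obtain p q where p: "\<forall>i<k. p i \<in> U i" and q: "\<forall>j<k. q j \<in> V j"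
      and det: "Determinant.det (mat k k (\<lambda>(i, j). \<psi> (p i) (q j))) \<noteq> 0"
      by blast
    have U: "?op (U k)" "U k \<noteq> {}" and V: "?op (V k)" "V k \<noteq> {}" using Suc.prems by auto
    have norm_q: "norm (q j) = 1" if "j < k" for j
      using norm_open[of "V j" "q j"] Suc.prems(2) q that by auto
    then have "finite (q ` {..<k})" "0 \<notin> q ` {..<k}" by force+
    then obtain x0 y where x0: "x0 \<in> U k" and y: "y \<in> V k" "y \<notin> span {x0}"
      and off: "\<And>z. z \<in> q ` {..<k} \<Longrightarrow> z \<notin> span {x0, y}"
      by (rule generic_great_circle[OF dim U V]) blast
    let ?B = "\<lambda>x. mat (Suc k) (Suc k) (\<lambda>(i, j). \<psi> ((p(k := x)) i) ((q(k := y)) j))"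
    obtain C where C: "\<forall>x. Determinant.det (?B x)
        = (\<Sum>j<k. C j * \<psi> x (q j)) + Determinant.det (mat k k (\<lambda>(i, j). \<psi> (p i) (q j))) * \<psi> x y"
      using det_bordered_expansion[of k \<psi> p q y] by (rule exE)
    have "\<exists>x\<in>U k. Determinant.det (?B x) \<noteq> 0"
    \<comment> \<open>If every bordered determinant vanished on \<open>U k\<close>, the expansion
      would be a relation along the chosen great circle, forcing its last coefficient, the old
      determinant, to be 0.\<close>
    proof (rule ccontr)
      assume "\<not> (\<exists>x\<in>U k. Determinant.det (?B x) \<noteq> 0)"
      then have rel: "(\<Sum>j<k. C j * arccos (inner x (q j)) ^ m)
          + Determinant.det (mat k k (\<lambda>(i, j). \<psi> (p i) (q j))) * arccos (inner x y) ^ m = 0"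
        if "x \<in> U k" for x
        using that C unfolding \<psi>_def by simp
      have "Determinant.det (mat k k (\<lambda>(i, j). \<psi> (p i) (q j))) = 0"
        by (rule arccos_power_coeff_zero[where J="{..<k}" and r=q and c=C,
              OF U(1) x0 norm_open[OF V(1) y(1)] y(2) _ _ _ m rel])
           (auto simp: norm_q off)
      then show False using det by contradiction
    qed
    then obtain x where x: "x \<in> U k" "Determinant.det (?B x) \<noteq> 0" by blast
    show ?case
      using p q x y(1)
      by (intro exI[of _ "p(k := x)"] exI[of _ "q(k := y)"]) (auto simp: less_Suc_eq)
  qed
  then show ?thesis
    unfolding full_rank_ae_def \<psi>_def by (simp add: vec_space_rank_iff_det)
qed

theorem proposition4:
  fixes n :: nat
  assumes "n \<ge> 2" and "DIM('a::euclidean_space) = n + 1"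
  shows "full_rank_ae (\<lambda>p q :: 'a. arccos (inner p q)) \<and>
         full_rank_ae (\<lambda>p q :: 'a. (arccos (inner p q))\<^sup>2)"
  using full_rank_ae_arccos_power[where 'a='a and m=1]
    full_rank_ae_arccos_power[where 'a='a and m=2] assms by simp

end
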